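(* Consider the $(n_0,\ldots,n_N)$ clustered multihop channel and a target diversity $d\le d_{\max}=\min_{i=1,\ldots,N}n_{i-1}n_i$. Set $\mathcal D_0=0$ and successively let $\mathcal D_i$ be the maximum integer in $(\mathcal D_{i-1},N]$ such that $$d^{\rm AF}_{(n_{\mathcal D_{i-1}},\ldots,n_{\mathcal D_i})}(0)\ge d$$ (until $N$ is reached). Then the decoding set $\{\mathcal D_i\}$ defines the serial partition of minimum size that achieves diversity $d$.
   Context: Multihop channel: layers $0,\ldots,N$ with $n_i\ge1$ antennas in layer $i$ (source = layer $0$, destination = layer $N$), with independent i.i.d. Rayleigh fading between adjacent layers. In the clustered case the relays of a layer may cooperatively decode and re-encode. Serial partition: a set of layer indices $\mathcal D=\{\mathcal D_1,\ldots,\mathcal D_{|\mathcal D|}\}$ with $0<\mathcal D_1<\mathcal D_2<\cdots<\mathcal D_{|\mathcal D|}:=N$, the layers in $\mathcal D$ performing cooperative decode-and-forward and all other layers performing amplify-and-forward (AF). Its size is $|\mathcal D|$. Its DMT is $$d_{\mathcal D}(r)=\min_{i=1,\ldots,|\mathcal D|}d^{\rm AF}_{(n_{\mathcal D_{i-1}},\ldots,n_{\mathcal D_i})}(r),\qquad\mathcal D_0:=0,$$ and it achieves diversity $d$ if $d_{\mathcal D}(0)\ge d$. Here $d^{\rm AF}_{(m_0,\ldots,m_M)}(r)$ is the DMT of the AF scheme in an $(m_0,\ldots,m_M)$ multihop channel; at $r=0$, with ordered dimensions $\tilde m_0\le\cdots\le\tilde m_M$, $$d^{\rm AF}_{(m_0,\ldots,m_M)}(0)=\sum_{i=1}^{\tilde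 m_0}\Big(1-i+\min_{k=1,\ldots,M}\Big\lfloor\frac{\sum_{l=0}^k\tilde m_l-i}{k}\Big\rfloor\Big).$$ *)

theory Defs imports Complex_Main begin

(* A tuple (m_0, ..., m_M) of antenna numbers is the list [m_0, ..., m_M].
   A "DMT family" f :: nat list => real => real assigns to such a tuple m and a
   multiplexing gain r the diversity gain f m r. *)

text \<open>Value at multiplexing gain 0 of the DMT of amplify-and-forward in an
  \<open>(m\<^sub>0, \<dots>, m\<^sub>M)\<close> multihop channel; \<open>sort m\<close> lists the ordered dimensions.
  Meaningful for at least two layers (\<open>M \<ge> 1\<close>), each with at least one antenna.\<close>

definition af_diversity :: "nat list \<Rightarrow> int" where
  "af_diversity m =
    (\<Sum>i = 1..sort m ! 0.
       1 - int i +
       Min ((\<lambda>k. \<lfloor>(real (\<Sum>l = 0..k. sort m ! l) - real i) / real k\<rfloor>) ` {1..length m - 1}))"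

definition layers :: "(nat \<Rightarrow> nat) \<Rightarrow> nat \<Rightarrow> nat \<Rightarrow> nat list" where
  "layers n a b = map n [a..<Suc b]"

definition serial_partition :: "nat \<Rightarrow> nat set \<Rightarrow> bool" where
  "serial_partition N D \<longleftrightarrow> D \<subseteq> {0<..N} \<and> N \<in> D"

text \<open>The increasing enumeration of a partition, preceded by the source layer 0;
  for \<open>0 \<notin> D\<close> the indices \<open>1, \<dots>, card D\<close> enumerate \<open>D\<close>.\<close>

definition partition_nth :: "nat set \<Rightarrow> nat \<Rightarrow> nat" where
  "partition_nth D i = sorted_list_of_set (insert 0 D) ! i"

definition serial_dmt ::
    "(nat list \<Rightarrow> real \<Rightarrow> real) \<Rightarrow> (nat \<Rightarrow> nat) \<Rightarrow> nat set \<Rightarrow> real \<Rightarrow> real" where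
  "serial_dmt dAF n D r =
    Min ((\<lambda>i. dAF (layers n (partition_nth D (i - 1)) (partition_nth D i)) r) ` {1..card D})"

definition achieves_diversity ::
    "(nat list \<Rightarrow> real \<Rightarrow> real) \<Rightarrow> (nat \<Rightarrow> nat) \<Rightarrow> real \<Rightarrow> nat set \<Rightarrow> bool" where
  "achieves_diversity dAF n d D \<longleftrightarrow> serial_dmt dAF n D 0 \<ge> d"

definition d_max :: "(nat \<Rightarrow> nat) \<Rightarrow> nat \<Rightarrow> nat" where
  "d_max n N = Min ((\<lambda>i. n (i - 1) * n i) ` {1..N})"

definition next_candidates ::
    "(nat list \<Rightarrow> real \<Rightarrow> real) \<Rightarrow> (nat \<Rightarrow> nat) \<Rightarrow> nat \<Rightarrow> real \<Rightarrow> nat \<Rightarrow> nat set" where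
  "next_candidates dAF n N d a = {j \<in> {a<..N}. dAF (layers n a j) 0 \<ge> d}"

text \<open>\<open>Max\<close> is unspecified on the empty set, so the values below are meaningful only as long
  as a candidate exists; in particular not beyond the first index at which \<open>N\<close> is reached.\<close>

primrec greedy ::
    "(nat list \<Rightarrow> real \<Rightarrow> real) \<Rightarrow> (nat \<Rightarrow> nat) \<Rightarrow> nat \<Rightarrow> real \<Rightarrow> nat \<Rightarrow> nat" where
  "greedy dAF n N d 0 = 0"
| "greedy dAF n N d (Suc i) = Max (next_candidates dAF n N d (greedy dAF n N d i))"

end

(* Inserting a dimension lowers every ordered dimension pointwise, and each summand of the
   AF diversity that disappears when the smallest dimension drops is positive; so the AF
   diversity of a section of the channel never decreases when the section is shortened.
   Hence greedy stays ahead: by induction its i-th layer is at least the i-th layer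
   of any partition achieving diversity d. *)
theory Submission imports Defs begin

section \<open>AF diversity of a section: monotonicity and the one-hop value\<close>

lemma sorted_insort_nth_le:
  fixes xs :: "'a::linorder list"
  assumes "sorted xs" "l < length xs"
  shows "insort x xs ! l \<le> xs ! l"
  using assms
proof (induction xs arbitrary: l)
  case (Cons y ys)
  show ?case
  proof (cases "x \<le> y")
    case True
    show ?thesis
    proof (cases l)
      \<comment> \<open>With \<open>x\<close> in front, position \<open>Suc l'\<close> holds the
        former entry \<open>l'\<close>.\<close>
      case (Suc l')
      then have "(y # ys) ! l' \<le> (y # ys) ! l"
        using Cons.prems by (intro sorted_nth_mono) auto
      with True Suc show ?thesis by simp
    qed (use True in simp)
  next
    case False
    with Cons show ?thesis by (cases l) auto
  qed
qed simp

text \<open>The comparison has two stages: \<open>term_le\<close> replaces the summands of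
  \<open>m'\<close> by those of \<open>m\<close> over the shorter index range, then
  \<open>nonneg\<close> allows that range to be extended up to \<open>sort m ! 0\<close>.\<close>

lemma af_diversity_antimono:
  assumes len: "2 \<le> length m" "length m \<le> length m'"
    and le: "\<And>l. l < length m \<Longrightarrow> sort m' ! l \<le> sort m ! l"
  shows "af_diversity m' \<le> af_diversity m"
proof -
  define t where "t = (\<lambda>(m::nat list) (i::nat) (k::nat).
    \<lfloor>(real (\<Sum>l = 0..k. sort m ! l) - real i) / real k\<rfloor>)"
  define T where "T = (\<lambda>m (i::nat). 1 - int i + Min (t m i ` {1..length m - 1}))"
  have af: "af_diversity m = (\<Sum>i = 1..sort m ! 0. T m i)" for m
    by (simp add: af_diversity_def T_def t_def)
  have term_le: "T m' i \<le> T m i" for i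
  proof -
    have "Min (t m' i ` {1..length m' - 1}) \<le> t m i k" if k: "k \<in> {1..length m - 1}" for k
    proof -
      have "(\<Sum>l = 0..k. sort m' ! l) \<le> (\<Sum>l = 0..k. sort m ! l)"
        using k by (intro sum_mono le) auto
      then have "t m' i k \<le> t m i k"
        unfolding t_def by (intro floor_mono divide_right_mono) (simp_all del: of_nat_sum)
      \<comment> \<open>Every \<open>k\<close> admissible for \<open>m\<close> is admissible for the
        longer \<open>m'\<close>, so the extra values of \<open>k\<close> can only lower the
        minimum.\<close>
      moreover have "Min (t m' i ` {1..length m' - 1}) \<le> t m' i k"
        using k len by (intro Min_le) auto
      ultimately show ?thesis by linarith
    qed
    then have "Min (t m' i ` {1..length m' - 1}) \<le> Min (t m i ` {1..length m - 1})"
      using len by (subst Min_ge_iff) auto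
    then show ?thesis by (simp add: T_def)
  qed
  \<comment> \<open>The first \<open>k + 1\<close> ordered dimensions are all at least
    \<open>i\<close>, so their sum less \<open>i\<close> is at least \<open>k * i\<close> and the
    floor is at least \<open>i\<close>.\<close>
  have nonneg: "0 \<le> T m i" if i: "i \<le> sort m ! 0" for i
  proof -
    have "int i \<le> t m i k" if k: "k \<in> {1..length m - 1}" for k
    proof -
      have "i \<le> sort m ! l" if "l \<le> k" for l
      proof -
        have "l < length (sort m)" using that k len unfolding atLeastAtMost_iff length_sort by linarith
        then have "sort m ! 0 \<le> sort m ! l" by (intro sorted_nth_mono) simp_all
        with i show ?thesis by linarith
      qed
      then have "(\<Sum>l = 0..k. i) \<le> (\<Sum>l = 0..k. sort m ! l)"
        by (intro sum_mono) auto
      then have "real (i + k * i) \<le> real (\<Sum>l = 0..k. sort m ! l)"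
        by (intro of_nat_mono) simp
      then have "real i \<le> (real (\<Sum>l = 0..k. sort m ! l) - real i) / real k"
        using k by (simp add: field_simps del: of_nat_sum)
      then show ?thesis unfolding t_def by (simp add: le_floor_iff del: of_nat_sum)
    qed
    then have "int i \<le> Min (t m i ` {1..length m - 1})"
      using len by (subst Min_ge_iff) auto
    then show ?thesis by (simp add: T_def)
  qed
  have "af_diversity m' \<le> (\<Sum>i = 1..sort m' ! 0. T m i)"
    unfolding af by (intro sum_mono term_le)
  also have "\<dots> \<le> (\<Sum>i = 1..sort m ! 0. T m i)"
  proof (intro sum_mono2 nonneg)
    have "0 < length m" using len by linarith
    then show "{1..sort m' ! 0} \<subseteq> {1..sort m ! 0}" using le[of 0] by auto
  qed auto
  finally show ?thesis unfolding af .
qed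

lemma af_diversity_Cons_le:
  assumes "2 \<le> length m"
  shows "af_diversity (x # m) \<le> af_diversity m"
  using assms by (intro af_diversity_antimono) (auto intro: sorted_insort_nth_le)

text \<open>Layers are dropped from the front one at a time; \<open>a' < b\<close> keeps at least
  one hop at every stage. Shortening at the source end suffices, because greedy and its competitor
  are compared at a common end layer.\<close>

lemma af_diversity_layers_mono:
  assumes "a \<le> a'" "a' < b"
  shows "af_diversity (layers n a b) \<le> af_diversity (layers n a' b)"
  using assms
proof (induction a' rule: dec_induct)
  case (step c)
  have "layers n c b = n c # layers n (Suc c) b"
    using step.prems by (simp add: layers_def upt_conv_Cons del: upt_Suc)
  moreover have "2 \<le> length (layers n (Suc c) b)"
    using step.prems by (simp add: layers_def)
  ultimately have "af_diversity (layers n c b) \<le> af_diversity (layers n (Suc c) b)"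
    using af_diversity_Cons_le by simp
  with step show ?case by simp
qed simp

text \<open>Only \<open>k = 1\<close> occurs, so the summands form an arithmetic progression. This
  links \<open>d_max\<close> to the AF diversity of single hops.\<close>

lemma af_diversity_pair: "af_diversity [a, b] = int a * int b"
proof -
  have *: "(\<Sum>i = 1..p. 1 - int i + (int (p + q) - int i)) = int p * int q" for p q :: nat
  proof -
    \<comment> \<open>The upper limit \<open>s\<close> is separated from the constant
      \<open>c\<close> so that induction on \<open>s\<close> leaves the summand unchanged.\<close>
    have "(\<Sum>i = 1..s. 1 - int i + (c - int i)) = int s * (c - int s)" for s c
      by (induction s) (auto simp: algebra_simps)
    from this[of "int (p + q)" p] show ?thesis by simp
  qed
  have fl: "\<lfloor>real p + real q - real i\<rfloor> = int (p + q) - int i" for p q i :: nat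
    by linarith
  show ?thesis
  proof (cases "a \<le> b")
    case True
    then show ?thesis using *[of a b] by (simp add: af_diversity_def fl)
  next
    case False
    then show ?thesis using *[of b a] by (simp add: af_diversity_def fl mult.commute)
  qed
qed

section \<open>Increasing enumeration of a serial partition\<close>

lemma
  assumes "serial_partition N D"
  shows partition_nth_0: "partition_nth D 0 = 0"
    and partition_nth_card: "partition_nth D (card D) = N"
    and partition_nth_less: "i < j \<Longrightarrow> j \<le> card D \<Longrightarrow> partition_nth D i < partition_nth D j"
proof -
  define xs where "xs = sorted_list_of_set (insert 0 D)"
  have D: "D \<subseteq> {0<..N}" "N \<in> D"
    using assms by (auto simp: serial_partition_def)
  then have fin: "finite D" "0 \<notin> D"
    by (auto intro: finite_subset)
  have set_xs: "set xs = insert 0 D" and len: "length xs = Suc (card D)"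
    using fin by (simp_all add: xs_def set_insort_key)
  have str: "sorted_wrt (<) xs"
    by (simp add: xs_def)
  show less: "partition_nth D i < partition_nth D j" if "i < j" "j \<le> card D" for i j
    using sorted_wrt_nth_less[OF str] that len by (simp add: partition_nth_def xs_def)
  \<comment> \<open>The entry 0 occurs at some position \<open>j\<close>; \<open>j > 0\<close> would
    put a smaller natural number before it.\<close>
  obtain j where j: "j \<le> card D" "xs ! j = 0"
    using set_xs len by (metis in_set_conv_nth insertI1 less_Suc_eq_le)
  then show "partition_nth D 0 = 0"
    using less[of 0 j] by (cases "j = 0") (auto simp: partition_nth_def xs_def)
  \<comment> \<open>Likewise \<open>N\<close> must stand last, since any later entry would exceed
    \<open>N\<close>.\<close>
  obtain l where l: "l \<le> card D" "xs ! l = N"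
    using set_xs len D by (metis in_set_conv_nth insertI2 less_Suc_eq_le)
  have "xs ! card D \<in> insert 0 D"
    using nth_mem[of "card D" xs] len set_xs by simp
  then have "xs ! card D \<le> N"
    using D by auto
  then show "partition_nth D (card D) = N"
    using l less[of l "card D"] by (cases "l = card D") (auto simp: partition_nth_def xs_def)
qed

text \<open>A partition is a bare set, so this recovers the greedy sequence from its image.\<close>

lemma partition_nth_image:
  assumes "strict_mono_on {0..K} g" "g 0 = 0" "i \<le> K"
  shows "partition_nth (g ` {1..K}) i = g i"
proof -
  have "sorted_wrt (<) (map g [0..<Suc K])"
    unfolding sorted_wrt_map
    using assms(1) by (intro sorted_wrt_mono_rel[OF _ sorted_wrt_upt]) (auto simp: strict_mono_on_def)
  moreover have "set (map g [0..<Suc K]) = insert 0 (g ` {1..K})"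
  proof -
    have "set [0..<Suc K] = insert 0 {1..K}" by auto
    then show ?thesis using assms(2) by (simp del: upt_Suc)
  qed
  ultimately have "sorted_list_of_set (insert 0 (g ` {1..K})) = map g [0..<Suc K]"
    by (metis sorted_list_of_set.idem_if_sorted_distinct strict_sorted_iff)
  then show ?thesis
    using assms(3) by (simp add: partition_nth_def del: upt_Suc)
qed

lemma achieves_diversity_iff:
  assumes "serial_partition N D"
  shows "achieves_diversity dAF n d D \<longleftrightarrow>
    (\<forall>i \<in> {1..card D}. d \<le> dAF (layers n (partition_nth D (i - 1)) (partition_nth D i)) 0)"
proof -
  have "finite D" "D \<noteq> {}"
    using assms by (auto simp: serial_partition_def intro: finite_subset)
  then have "card D \<ge> 1"
    by (simp add: Suc_leI card_gt_0_iff)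
  then show ?thesis
    unfolding achieves_diversity_def serial_dmt_def by (subst Min_ge_iff) auto
qed

section \<open>The greedy partition: termination, validity and minimality\<close>

theorem propositionV1:
  fixes dAF :: "nat list \<Rightarrow> real \<Rightarrow> real" and n :: "nat \<Rightarrow> nat" and N :: nat and d :: real
  assumes dAF_zero: "\<And>m. length m \<ge> 2 \<Longrightarrow> (\<forall>x \<in> set m. x \<ge> 1) \<Longrightarrow>
                       dAF m 0 = real_of_int (af_diversity m)"
    and "N \<ge> 1"
    and "\<And>i. i \<le> N \<Longrightarrow> n i \<ge> 1"
    and "d \<le> real (d_max n N)"
  shows "\<exists>K. greedy dAF n N d K = N \<and>
             (\<forall>i<K. greedy dAF n N d i < N \<and> next_candidates dAF n N d (greedy dAF n N d i) \<noteq> {}) \<and>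
             is_arg_min card (\<lambda>D. serial_partition N D \<and> achieves_diversity dAF n d D)
               (greedy dAF n N d ` {1..K})"
proof -
  define g where "g = greedy dAF n N d"
  define C where "C = next_candidates dAF n N d"
  have g_0: "g 0 = 0" and g_Suc: "g (Suc i) = Max (C (g i))" for i
    by (simp_all add: g_def C_def)
  have C_iff: "j \<in> C a \<longleftrightarrow> a < j \<and> j \<le> N \<and> d \<le> dAF (layers n a j) 0" for j a
    by (auto simp: C_def next_candidates_def)
  have fin_C: "finite (C a)" for a
    by (auto simp: C_def next_candidates_def)
  have dAF_layers: "dAF (layers n a b) 0 = real_of_int (af_diversity (layers n a b))"
    if "a < b" "b \<le> N" for a b
    using that assms(3) by (intro dAF_zero) (auto simp: layers_def)
  \<comment> \<open>The bound on \<open>d\<close> enters here: a single hop always reaches diversity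
    \<open>d_max\<close>, so below \<open>N\<close> a candidate exists and \<open>Max\<close> is
    meaningful.\<close>
  have Suc_in_C: "Suc a \<in> C a" if "a < N" for a
  proof -
    have "d_max n N \<le> n (Suc a - 1) * n (Suc a)"
      unfolding d_max_def using that by (intro Min_le) (auto intro!: image_eqI[of _ _ "Suc a"])
    then have "real (d_max n N) \<le> real (n a * n (Suc a))"
      by (intro of_nat_mono) simp
    also have "\<dots> = dAF (layers n a (Suc a)) 0"
      using that by (subst dAF_layers) (simp_all add: layers_def af_diversity_pair)
    finally show ?thesis
      using that assms(4) by (simp add: C_iff)
  qed
  have g_step: "g (Suc i) \<in> C (g i)" if "g i < N" for i
    unfolding g_Suc using Suc_in_C[OF that] fin_C by (intro Max_in) auto
  have "\<exists>K. g K = N"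
  proof (rule ccontr)
    assume neq: "\<nexists>K. g K = N"
    \<comment> \<open>If \<open>N\<close> were never hit, \<open>g\<close> would grow by at least 1
      per step yet stay below \<open>N\<close>, which fails at \<open>i = N\<close>.\<close>
    have "i \<le> g i \<and> g i < N" for i
    proof (induction i)
      case 0
      show ?case using assms(2) g_0 by simp
    next
      case (Suc i)
      moreover have "g (Suc i) \<noteq> N" using neq by blast
      ultimately show ?case using g_step[of i] by (auto simp: C_iff)
    qed
    from this[of N] show False by linarith
  qed
  \<comment> \<open>The first hit is taken, as \<open>g\<close> is unspecified beyond it.\<close>
  define K where "K = (LEAST K. g K = N)"
  have g_K: "g K = N"
    unfolding K_def using \<open>\<exists>K. g K = N\<close> by (rule LeastI_ex)
  have g_less: "g i < N" if "i < K" for i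
    using that
  proof (induction i)
    case 0
    show ?case using assms(2) g_0 by simp
  next
    case (Suc i)
    then have "g (Suc i) \<le> N"
      using g_step[of i] by (auto simp: C_iff)
    moreover have "g (Suc i) \<noteq> N"
      using Suc.prems not_less_Least unfolding K_def by blast
    ultimately show ?case by simp
  qed
  have g_mono: "g i < g j" if "i < j" "j \<le> K" for i j
    using that
  proof (induction j)
    case (Suc j)
    then have "g j < g (Suc j)"
      using g_less[of j] g_step[of j] by (auto simp: C_iff)
    with Suc show ?case by (cases "i = j") auto
  qed simp
  then have smono: "strict_mono_on {0..K} g"
    by (auto simp: strict_mono_on_def)
  have "inj_on g {1..K}"
    using smono by (auto dest!: strict_mono_on_imp_inj_on intro: inj_on_subset)
  then have card_g: "card (g ` {1..K}) = K"
    by (simp add: card_image)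
  have "K \<noteq> 0"
    using g_K g_0 assms(2) by (metis not_one_le_zero)
  have part: "serial_partition N (g ` {1..K})"
    unfolding serial_partition_def
  proof
    show "g ` {1..K} \<subseteq> {0<..N}"
    proof
      fix x assume "x \<in> g ` {1..K}"
      then obtain i where i: "x = g i" "0 < i" "i \<le> K" by auto
      then show "x \<in> {0<..N}"
        using g_mono[of 0 i] g_less[of i] g_K g_0 by (cases "i = K") auto
    qed
    show "N \<in> g ` {1..K}"
      using g_K \<open>K \<noteq> 0\<close> by (intro image_eqI[of _ _ K]) auto
  qed
  have achieves: "achieves_diversity dAF n d (g ` {1..K})"
    unfolding achieves_diversity_iff[OF part] card_g
  proof
    fix i assume i: "i \<in> {1..K}"
    then have *: "i - 1 < K" "i - 1 \<le> K" "i \<le> K" "Suc (i - 1) = i" by auto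
    then have "g i \<in> C (g (i - 1))"
      using g_less[of "i - 1"] g_step[of "i - 1"] by simp
    then show "d \<le> dAF (layers n (partition_nth (g ` {1..K}) (i - 1)) (partition_nth (g ` {1..K}) i)) 0"
      unfolding partition_nth_image[OF smono g_0 *(2)] partition_nth_image[OF smono g_0 *(3)] C_iff
      by blast
  qed
  have minimal: "K \<le> card D"
    if D: "serial_partition N D" "achieves_diversity dAF n d D" for D
  proof (rule ccontr)
    assume "\<not> K \<le> card D"
    \<comment> \<open>This keeps every index up to \<open>card D\<close> in the range where
      \<open>g\<close> is strictly increasing and below \<open>N\<close>.\<close>
    then have less: "card D < K" by simp
    define p where "p = partition_nth D"
    have p_le: "p i \<le> N" if "i \<le> card D" for i
      using that partition_nth_less[OF D(1), of i "card D"] partition_nth_card[OF D(1)]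
      unfolding p_def by (cases "i = card D") auto
    have "p i \<le> g i" if "i \<le> card D" for i
      using that
    proof (induction i)
      case 0
      show ?case by (simp add: p_def partition_nth_0[OF D(1)])
    next
      case (Suc i)
      have gi: "g i < g (Suc i)"
        using Suc.prems less by (intro g_mono) auto
      show ?case
      proof (cases "p (Suc i) \<le> g i")
        case True
        with gi show ?thesis by simp
      next
        \<comment> \<open>The section from \<open>g i\<close> to \<open>p (Suc i)\<close> is now a
          tail of a section of \<open>D\<close>, hence still has diversity at least
          \<open>d\<close>; so \<open>p (Suc i)\<close> is a candidate that the greedy maximum
          cannot fall short of.\<close>
        case False
        have pp: "p i < p (Suc i)" "p (Suc i) \<le> N"
          using partition_nth_less[OF D(1), of i "Suc i"] p_le Suc.prems by (auto simp: p_def)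
        have "Suc i \<in> {1..card D}" using Suc.prems by simp
        with D(2) have "d \<le> dAF (layers n (p i) (p (Suc i))) 0"
          unfolding achieves_diversity_iff[OF D(1)] p_def by (metis diff_Suc_1)
        also have "\<dots> \<le> dAF (layers n (g i) (p (Suc i))) 0"
          using False pp Suc af_diversity_layers_mono[of "p i" "g i" "p (Suc i)" n]
          by (simp add: dAF_layers)
        finally have "p (Suc i) \<in> C (g i)"
          using False pp by (simp add: C_iff)
        then show ?thesis
          unfolding g_Suc using fin_C by (intro Max_ge)
      qed
    qed
    from this[of "card D"] have "N \<le> g (card D)"
      by (simp add: p_def partition_nth_card[OF D(1)])
    with g_less[OF less] show False by simp
  qed
  have "is_arg_min card (\<lambda>D. serial_partition N D \<and> achieves_diversity dAF n d D) (g ` {1..K})"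
    unfolding is_arg_min_def card_g using part achieves minimal by (auto simp: not_less)
  moreover have "\<forall>i<K. g i < N \<and> C (g i) \<noteq> {}"
    using g_less Suc_in_C by blast
  ultimately show ?thesis
    using g_K unfolding g_def C_def by blast
qed

end
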